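(* Any randomized streaming algorithm that approximates the length of the longest palindrome in a stream of length $\ell$ up to an additive error of $e_r$ elements must use $\Omega(\ell/e_r)$ space.
   Context: Streaming model: the input is a string over an alphabet $\Sigma\subset\mathbb N$, read once from left to right. A palindrome is a substring that reads the same forwards and backwards; the algorithm must output an estimate of the length of a longest palindromic substring that differs from the true value by at most $e_r$. Space is measured in memory cells, each able to store one symbol of $\Sigma$; the bound refers to the expected space on a worst-case input.
   Formalization: The alphabet is assumed finite with at least two symbols, the error e_r is a positive integer, and the stream length satisfies ℓ ≥ 2e_r+5; without such conditions the bound fails (e.g. over two symbols with ℓ = 2e_r+4 ≥ 9 the constant estimate ℓ−e_r needs no memory). *)

theory Defs
  imports "HOL-Library.Sublist" "HOL-Probability.Probability"
begin

definition palindrome :: "'a list \<Rightarrow> bool" where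
  "palindrome u \<longleftrightarrow> rev u = u"

definition longest_palindrome_length :: "'a list \<Rightarrow> nat" where
  "longest_palindrome_length w = Max {length u | u. sublist u w \<and> palindrome u}"

text \<open>
  The memory of a streaming algorithm is the list of the symbols held in its occupied cells.
  Everything the algorithm remembers of the symbols already read is in that list. The number of
  symbols read so far is available free of charge (first argument of \<open>step\<close>), so that random
  choices made anew at every step are covered when the algorithm is drawn at random.
\<close>

record stream_alg =
  start :: "nat list"
  step :: "nat \<Rightarrow> nat list \<Rightarrow> nat \<Rightarrow> nat list"
  estimate :: "nat list \<Rightarrow> real"

definition cells_over :: "nat set \<Rightarrow> stream_alg \<Rightarrow> bool" where
  "cells_over S A \<longleftrightarrow>
     start A \<in> lists S \<and> (\<forall>t. \<forall>mem\<in>lists S. \<forall>a\<in>S. step A t mem a \<in> lists S)"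

primrec memory_after :: "stream_alg \<Rightarrow> nat list \<Rightarrow> nat \<Rightarrow> nat list" where
  "memory_after A w 0 = start A"
| "memory_after A w (Suc t) = step A t (memory_after A w t) (w ! t)"

definition space_used :: "stream_alg \<Rightarrow> nat list \<Rightarrow> nat" where
  "space_used A w = Max ((\<lambda>t. length (memory_after A w t)) ` {..length w})"

definition result :: "stream_alg \<Rightarrow> nat list \<Rightarrow> real" where
  "result A w = estimate A (memory_after A w (length w))"

definition streams_of_length :: "nat set \<Rightarrow> nat \<Rightarrow> nat list set" where
  "streams_of_length S l = {w \<in> lists S. length w = l}"

text \<open>
  A randomized algorithm is a probability distribution over deterministic ones. The sigma-algebra
  is arbitrary as long as the space used on each input is a random variable. Distributions
  induced by random tapes of any kind are therefore included.
\<close>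

definition randomized_alg :: "nat set \<Rightarrow> nat \<Rightarrow> stream_alg measure \<Rightarrow> bool" where
  "randomized_alg S l P \<longleftrightarrow>
     prob_space P \<and> (\<forall>A\<in>space P. cells_over S A) \<and>
     (\<forall>w\<in>streams_of_length S l. (\<lambda>A. space_used A w) \<in> measurable P (count_space UNIV))"

definition approximates_longest_palindrome ::
    "nat set \<Rightarrow> nat \<Rightarrow> nat \<Rightarrow> stream_alg measure \<Rightarrow> bool" where
  "approximates_longest_palindrome S l e P \<longleftrightarrow>
     (\<forall>w\<in>streams_of_length S l.
        AE A in P. \<bar>result A w - real (longest_palindrome_length w)\<bar> \<le> real e)"

definition expected_space :: "stream_alg measure \<Rightarrow> nat list \<Rightarrow> ennreal" where
  "expected_space P w = (\<integral>\<^sup>+ A. of_nat (space_used A w) \<partial>P)"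

definition worst_case_space :: "nat set \<Rightarrow> nat \<Rightarrow> stream_alg measure \<Rightarrow> ennreal" where
  "worst_case_space S l P = (SUP w\<in>streams_of_length S l. expected_space P w)"

text \<open>
  The lower bound is stated with one constant for all alphabets, lengths, error bounds and
  algorithms. A side condition bounding \<open>l\<close> below in terms of \<open>e\<close> cannot be avoided: over two
  symbols every string of length at least 9 contains a palindrome of length 4 or more, so for
  \<open>9 \<le> l \<le> 2 * e + 4\<close> the constant estimate \<open>l - e\<close> is correct and needs no memory. The
  condition \<open>2 * e + 5 \<le> l\<close> excludes this range and nothing above it. An alphabet with
  a single symbol is likewise trivial, and over an infinite one a single cell can
  encode the whole past.
\<close>

end

theory Submission
  imports Defs
begin

text \<open>
  A correct randomized algorithm is almost surely correct on all of the finitely many inputs, so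
  it suffices to bound, for each correct deterministic algorithm, the average space over a fixed
  finite family of inputs. For \<open>l > 16 * e\<close> consider the prefixes \<open>a\<^sup>2\<^sup>e b u\<close> with \<open>u\<close> an
  arbitrary word over the alphabet. In \<open>a\<^sup>2\<^sup>e b u c (a\<^sup>2\<^sup>e b v)\<^sup>R\<close> the two letters \<open>b\<close> next
  to the padding force every palindrome of length at least \<open>l - 2 * e\<close> to be centred in the
  middle, and then \<open>u = v\<close>. Hence the memory after the prefix determines \<open>u\<close>, and by counting
  the average memory is linear in \<open>l\<close>. For the remaining lengths a positive constant suffices,
  and an algorithm that uses no memory cannot distinguish \<open>a\<^sup>l\<close> from a word all of whose
  palindromes have length at most 4.
\<close>

section \<open>Bounding and evaluating the longest palindrome length\<close>

lemma palindromic_sublists_finite: "finite {length u | u. sublist u w \<and> palindrome u}"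
  by (rule finite_subset[of _ "{..length w}"]) (auto dest: sublist_length_le)

lemma longest_palindrome_length_le:
  assumes "\<And>u. sublist u w \<Longrightarrow> palindrome u \<Longrightarrow> length u \<le> k"
  shows "longest_palindrome_length w \<le> k"
proof -
  have "0 \<in> {length u | u. sublist u w \<and> palindrome u}"
    by (auto simp: palindrome_def intro!: exI[of _ "[]"])
  then show ?thesis
    unfolding longest_palindrome_length_def
    using assms palindromic_sublists_finite by (subst Max_le_iff) auto
qed

lemma longest_palindrome_length_palindrome:
  assumes "palindrome w"
  shows "longest_palindrome_length w = length w"
  unfolding longest_palindrome_length_def
  using assms by (intro Max_eqI palindromic_sublists_finite) (auto dest: sublist_length_le)

subsection \<open>Long palindromes have to be centred\<close>

definition padded :: "'a \<Rightarrow> 'a \<Rightarrow> nat \<Rightarrow> 'a list \<Rightarrow> 'a list" where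
  "padded a b e u = replicate (2 * e) a @ b # u"

lemma length_padded [simp]: "length (padded a b e u) = 2 * e + 1 + length u"
  by (simp add: padded_def)

lemma nth_padded:
  "i < 2 * e \<Longrightarrow> (padded a b e u @ z) ! i = a"
  "(padded a b e u @ z) ! (2 * e) = b"
  "k < length u \<Longrightarrow> (padded a b e u @ z) ! (2 * e + 1 + k) = u ! k"
  by (auto simp: padded_def nth_append)

text \<open>If \<open>t\<close> misses \<open>s\<close> letters of \<open>w\<close> on the left and
  \<open>r\<close> on the right, then \<open>w\<close> agrees on the window of \<open>t\<close> with
  \<open>rev w\<close> shifted by \<open>r - s\<close>. A nonzero shift of at most
  \<open>2 * e\<close> would match the letter \<open>b\<close> after one run with a letter
  \<open>a\<close> of the other run. With zero shift, \<open>u\<close> and \<open>v\<close> are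
  compared letter by letter.\<close>

lemma long_palindrome_in_padded:
  assumes "a \<noteq> b" and len: "length u = length v"
    and w: "w = padded a b e u @ c @ rev (padded a b e v)"
    and t: "sublist t w" "palindrome t" "length w \<le> length t + 2 * e"
  shows "u = v"
proof -
  obtain p q where pq: "w = p @ t @ q"
    using t(1) by (auto simp: sublist_def)
  define s r where "s = length p" and "r = length q"
  have lw: "length w = s + length t + r" and sr: "s + r \<le> 2 * e"
    using t(3) by (auto simp: pq s_def r_def)
  have lw2: "length w = 4 * e + 2 + length c + 2 * length v"
    using len by (simp add: w)
  have revw: "rev w = padded a b e v @ rev c @ rev (padded a b e u)"
    by (simp add: w)
  have revw': "rev w = rev q @ t @ rev p"
    using t(2) by (simp add: pq palindrome_def)
  have mirror: "w ! (s + j) = rev w ! (r + j)" if "j < length t" for j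
  proof -
    have "w ! (s + j) = t ! j"
      using that by (simp add: pq s_def nth_append)
    moreover have "rev w ! (r + j) = t ! j"
      unfolding revw' using that by (simp add: r_def nth_append)
    ultimately show ?thesis by simp
  qed
  have "\<not> r < s"
  proof
    assume "r < s"
    \<comment> \<open>The index \<open>2 * e - s\<close> picks the \<open>b\<close> after the run in
      \<open>w\<close>; in \<open>rev w\<close> it lands \<open>s - r\<close> places earlier, inside
      the run.\<close>
    then have "w ! (2 * e) = rev w ! (2 * e - (s - r))"
      using mirror[of "2 * e - s"] sr lw lw2 by (simp add: add.commute)
    moreover have "w ! (2 * e) = b"
      unfolding w by (rule nth_padded)
    moreover have "rev w ! (2 * e - (s - r)) = a"
      unfolding revw using \<open>r < s\<close> sr by (intro nth_padded) simp
    ultimately show False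
      using assms(1) by simp
  qed
  moreover have "\<not> s < r"
  proof
    assume "s < r"
    then have "w ! (2 * e - (r - s)) = rev w ! (2 * e)"
      using mirror[of "2 * e - r"] sr lw lw2 by (simp add: add.commute)
    moreover have "rev w ! (2 * e) = b"
      unfolding revw by (rule nth_padded)
    moreover have "w ! (2 * e - (r - s)) = a"
      unfolding w using \<open>s < r\<close> sr by (intro nth_padded) simp
    ultimately show False
      using assms(1) by simp
  qed
  ultimately have "s = r" by simp
  show "u = v"
  proof (rule nth_equalityI[OF len])
    fix k assume k: "k < length u"
    have "w ! (2 * e + 1 + k) = rev w ! (2 * e + 1 + k)"
      using mirror[of "2 * e + 1 + k - s"] \<open>s = r\<close> sr lw lw2 k len by simp
    moreover have "w ! (2 * e + 1 + k) = u ! k"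
      unfolding w by (rule nth_padded(3)[OF k])
    moreover have "rev w ! (2 * e + 1 + k) = v ! k"
      unfolding revw using k len by (intro nth_padded) simp
    ultimately show "u ! k = v ! k" by simp
  qed
qed

text \<open>Strictness matters: for palindromic \<open>c\<close>, the true lengths for
  \<open>u = v\<close> and \<open>u \<noteq> v\<close> differ by more than \<open>2 * e\<close>, so
  no estimate is within \<open>e\<close> of both.\<close>

lemma longest_palindrome_length_padded:
  assumes "a \<noteq> b" "length u = length v" "u \<noteq> v"
    and "w = padded a b e u @ c @ rev (padded a b e v)"
  shows "longest_palindrome_length w + 2 * e < length w"
proof -
  have "length w > 2 * e"
    using assms(4) by simp
  moreover have "longest_palindrome_length w \<le> length w - 2 * e - 1"
  proof (rule longest_palindrome_length_le)
    fix t assume "sublist t w" "palindrome t"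
    then have "\<not> length w \<le> length t + 2 * e"
      using long_palindrome_in_padded[OF assms(1,2,4)] assms(3) by blast
    then show "length t \<le> length w - 2 * e - 1" by simp
  qed
  ultimately show ?thesis by simp
qed

subsection \<open>A word with short palindromes\<close>

text \<open>The prefixes of \<open>(aababb)\<^sup>\<omega>\<close>.\<close>

definition short_palindromes_word :: "'a \<Rightarrow> 'a \<Rightarrow> nat \<Rightarrow> 'a list" where
  "short_palindromes_word a b l = map (\<lambda>i. if i mod 6 \<in> {2, 4, 5} then b else a) [0..<l]"

text \<open>Stripping both ends of a palindrome equally leaves a palindrome, so a length of at least
  5 would yield a central palindrome of length 5 or 6. By periodicity only six starting positions
  have to be refuted.\<close>

lemma longest_palindrome_length_short_palindromes_word:
  assumes "a \<noteq> b"
  shows "longest_palindrome_length (short_palindromes_word a b l) \<le> 4"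
proof (rule longest_palindrome_length_le, rule ccontr)
  fix t assume t: "sublist t (short_palindromes_word a b l)" "palindrome t"
    and "\<not> length t \<le> 4"
  then have n: "length t \<ge> 5" by simp
  define f where "f i \<longleftrightarrow> i mod 6 \<in> {2, 4, 5}" for i :: nat
  obtain p q where pq: "short_palindromes_word a b l = p @ t @ q"
    using t(1) by (auto simp: sublist_def)
  have t_nth: "t ! j = (if f (length p + j) then b else a)" if "j < length t" for j
  proof -
    have "length p + j < l"
      using that arg_cong[OF pq, of length] by (simp add: short_palindromes_word_def)
    then have "(p @ t @ q) ! (length p + j) = (if f (length p + j) then b else a)"
      unfolding pq[symmetric] by (simp add: short_palindromes_word_def f_def)
    then show ?thesis
      using that by (simp add: nth_append)
  qed
  have mirror: "f (length p + j) = f (length p + (length t - Suc j))" if "j < length t" for j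
  proof -
    have "t ! j = t ! (length t - Suc j)"
      using rev_nth[OF that] t(2) by (simp add: palindrome_def)
    then show ?thesis
      using t_nth[of j] t_nth[of "length t - Suc j"] that assms by (auto split: if_splits)
  qed
  have f_add: "f (x + k) = f (x mod 6 + k)" for x k
    by (simp add: f_def mod_add_left_eq)
  have no5: False if "f x = f (x + 4)" "f (x + 1) = f (x + 3)" for x
  proof -
    have "x mod 6 \<in> {0, 1, 2, 3, 4, 5}" by auto
    moreover have "f (x mod 6) = f (x mod 6 + 4)" "f (x mod 6 + 1) = f (x mod 6 + 3)"
      using that f_add[of x 0] by (simp_all only: f_add[of x] add_0_right)
    ultimately show False
      by (elim insertE) (simp_all add: f_def)
  qed
  have no6: False if "f x = f (x + 5)" "f (x + 1) = f (x + 4)" "f (x + 2) = f (x + 3)" for x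
  proof -
    have "x mod 6 \<in> {0, 1, 2, 3, 4, 5}" by auto
    moreover have "f (x mod 6) = f (x mod 6 + 5)" "f (x mod 6 + 1) = f (x mod 6 + 4)"
      "f (x mod 6 + 2) = f (x mod 6 + 3)"
      using that f_add[of x 0] by (simp_all only: f_add[of x] add_0_right)
    ultimately show False
      by (elim insertE) (simp_all add: f_def)
  qed
  show False
  proof (cases "even (length t)")
    case True
    then obtain k where "length t = 2 * k" by blast
    \<comment> \<open>The subtraction does not truncate, since an even length of at least 5 is at
      least 6. The \<open>i\<close> obtained next counts the letters stripped from each
      side.\<close>
    then have "length t = 2 * (k - 3) + 6"
      using n by simp
    then obtain i where "length t = 2 * i + 6" by blast
    then show False
      using no6[of "length p + i"] mirror[of i] mirror[of "i + 1"] mirror[of "i + 2"]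
      by (simp add: ac_simps)
  next
    case False
    then obtain k where "length t = 2 * k + 1" by (auto elim: oddE)
    then have "length t = 2 * (k - 2) + 5"
      using n by simp
    then obtain i where "length t = 2 * i + 5" by blast
    then show False
      using no5[of "length p + i"] mirror[of i] mirror[of "i + 1"]
      by (simp add: ac_simps)
  qed
qed

subsection \<open>Memory of deterministic algorithms\<close>

lemma memory_after_in_lists:
  assumes "cells_over S A" "w \<in> lists S" "t \<le> length w"
  shows "memory_after A w t \<in> lists S"
  using assms(3)
proof (induction t)
  case 0
  then show ?case
    using assms(1) by (simp add: cells_over_def)
next
  case (Suc t)
  then have "w ! t \<in> S"
    using assms(2) by auto
  then show ?case
    using Suc assms(1) by (simp add: cells_over_def)
qed

lemma memory_after_append:
  "t \<le> length x \<Longrightarrow> memory_after A (x @ z) t = memory_after A x t"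
  by (induction t) (auto simp: nth_append)

text \<open>Equal lengths are needed besides equal memory because \<open>step\<close> also sees the
  number of symbols read.\<close>

lemma result_append_eq:
  assumes "length x = length y" "memory_after A x (length x) = memory_after A y (length y)"
  shows "result A (x @ z) = result A (y @ z)"
proof -
  have "memory_after A (x @ z) (length x + t) = memory_after A (y @ z) (length y + t)" for t
    using assms by (induction t) (auto simp: memory_after_append nth_append)
  then show ?thesis
    by (simp add: result_def)
qed

lemma length_memory_after_le_space_used:
  "t \<le> length w \<Longrightarrow> length (memory_after A w t) \<le> space_used A w"
  unfolding space_used_def by (intro Max_ge) auto

lemma result_no_space:
  assumes "space_used A w = 0"
  shows "result A w = estimate A []"
  using length_memory_after_le_space_used[of "length w" w A] assms by (simp add: result_def)

text \<open>There are at most \<open>card S ^ (m - 1)\<close> words shorter than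
  \<open>m - 1\<close>, which is at most half of \<open>card F\<close>. By injectivity, at least
  half of \<open>F\<close> is sent to words of length at least \<open>m - 1\<close>.\<close>

lemma sum_length_ge:
  assumes "finite S" "card S \<ge> 2" and F: "finite F" "card F = card S ^ m"
    and f: "inj_on f F" "f ` F \<subseteq> lists S"
  shows "(m - 1) * card F \<le> 2 * (\<Sum>x\<in>F. length (f x))"
proof (cases "m < 2")
  case True
  then show ?thesis by simp
next
  case False
  define B where "B = {x \<in> F. length (f x) < m - 1}"
  have geometric: "(\<Sum>i<k. card S ^ i) \<le> card S ^ k" for k
  proof (induction k)
    case (Suc k)
    then have "(\<Sum>i<Suc k. card S ^ i) \<le> 2 * card S ^ k" by simp
    also have "\<dots> \<le> card S ^ Suc k"
      using assms(2) by simp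
    finally show ?case .
  qed simp
  have "card B = card (f ` B)"
    using f(1) by (intro card_image[symmetric] inj_on_subset[OF f(1)]) (auto simp: B_def)
  also have "\<dots> \<le> card {xs. set xs \<subseteq> S \<and> length xs \<le> m - 2}"
    using f(2) finite_lists_length_le[OF assms(1)] False
    by (intro card_mono) (auto simp: B_def)
  also have "\<dots> = (\<Sum>i<m - 1. card S ^ i)"
    using False by (simp add: card_lists_length_le[OF assms(1)] lessThan_Suc_atMost[symmetric]
        Suc_diff_le numeral_2_eq_2 Suc_diff_Suc)
  also have "\<dots> \<le> card S ^ (m - 1)" by (rule geometric)
  finally have "2 * card B \<le> card S * card S ^ (m - 1)"
    using assms(2) by (metis mult_le_mono)
  also have "\<dots> = card F"
    using F(2) False by (cases m) auto
  finally have B: "2 * card B \<le> card F" .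
  have "card (F - B) = card F - card B"
    using F(1) by (intro card_Diff_subset) (auto simp: B_def)
  then have "card F \<le> 2 * card (F - B)"
    using B by simp
  then have "(m - 1) * card F \<le> 2 * (\<Sum>x\<in>F - B. m - 1)" by simp
  also have "\<dots> \<le> 2 * (\<Sum>x\<in>F - B. length (f x))"
    by (intro mult_le_mono order_refl sum_mono) (auto simp: B_def)
  also have "\<dots> \<le> 2 * (\<Sum>x\<in>F. length (f x))"
    using F(1) by (intro mult_le_mono order_refl sum_mono2) auto
  finally show ?thesis .
qed

subsection \<open>From deterministic to randomized algorithms\<close>

text \<open>The averaging direction of Yao's principle: the worst input costs at least the average
  over \<open>F\<close>, and exchanging sum and integral reduces this to a bound for almost every
  deterministic algorithm.\<close>

lemma worst_case_space_ge_average: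
  assumes P: "randomized_alg S l P"
    and F: "finite F" "F \<noteq> {}" "g ` F \<subseteq> streams_of_length S l"
    and ae: "AE A in P. r * real (card F) \<le> real (\<Sum>x\<in>F. space_used A (g x))"
  shows "ennreal r \<le> worst_case_space S l P"
proof -
  interpret prob_space P
    using P by (simp add: randomized_alg_def)
  have "ennreal r * of_nat (card F) = ennreal (r * real (card F))"
    by (simp add: ennreal_mult'' ennreal_of_nat_eq_real_of_nat)
  also have "\<dots> = (\<integral>\<^sup>+ A. ennreal (r * real (card F)) \<partial>P)"
    by (simp add: emeasure_space_1)
  also have "\<dots> \<le> (\<integral>\<^sup>+ A. (\<Sum>x\<in>F. of_nat (space_used A (g x))) \<partial>P)"
  proof (rule nn_integral_mono_AE, use ae in eventually_elim)
    case (elim A)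
    then have "ennreal (r * real (card F)) \<le> ennreal (real (\<Sum>x\<in>F. space_used A (g x)))"
      by (rule ennreal_leI)
    then show ?case
      unfolding ennreal_of_nat_eq_real_of_nat[symmetric] by simp
  qed
  also have "\<dots> = (\<Sum>x\<in>F. expected_space P (g x))"
    unfolding expected_space_def
  proof (rule nn_integral_sum)
    fix x assume "x \<in> F"
    then have "(\<lambda>A. space_used A (g x)) \<in> measurable P (count_space UNIV)"
      using P F(3) by (auto simp: randomized_alg_def)
    then show "(\<lambda>A. of_nat (space_used A (g x)) :: ennreal) \<in> borel_measurable P"
      by (rule measurable_compose) simp
  qed
  also have "\<dots> \<le> (\<Sum>x\<in>F. worst_case_space S l P)"
    unfolding worst_case_space_def using F(3) by (intro sum_mono SUP_upper) auto
  also have "\<dots> = worst_case_space S l P * of_nat (card F)"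
    by (simp add: mult.commute)
  \<comment> \<open>Cancelling in \<open>ennreal\<close> requires a factor that is neither zero nor
    infinite.\<close>
  finally have "ennreal r * of_nat (card F) / of_nat (card F)
      \<le> worst_case_space S l P * of_nat (card F) / of_nat (card F)"
    by (rule divide_right_mono_ennreal)
  moreover have "(of_nat (card F) :: ennreal) \<noteq> 0"
    using F by simp
  ultimately show ?thesis
    by (simp add: mult_divide_eq_ennreal)
qed

section \<open>Almost surely correct algorithms and the two lower bounds\<close>

definition correct_alg :: "nat set \<Rightarrow> nat \<Rightarrow> nat \<Rightarrow> stream_alg \<Rightarrow> bool" where
  "correct_alg S l e A \<longleftrightarrow> cells_over S A \<and>
     (\<forall>w\<in>streams_of_length S l. \<bar>result A w - real (longest_palindrome_length w)\<bar> \<le> real e)"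

text \<open>The null set of failing algorithms may depend on the input; a finite alphabet leaves
  finitely many inputs, hence a null union.\<close>

lemma AE_correct_alg:
  assumes "finite S" "randomized_alg S l P" "approximates_longest_palindrome S l e P"
  shows "AE A in P. correct_alg S l e A"
proof -
  have "streams_of_length S l = {w. set w \<subseteq> S \<and> length w = l}"
    by (auto simp: streams_of_length_def)
  then have fin: "finite (streams_of_length S l)"
    using finite_lists_length_eq[OF assms(1)] by simp
  have "AE A in P. \<forall>w\<in>streams_of_length S l.
      \<bar>result A w - real (longest_palindrome_length w)\<bar> \<le> real e"
    using assms(3) by (subst AE_finite_all[OF fin])
      (auto simp: approximates_longest_palindrome_def)
  moreover have "AE A in P. cells_over S A"
    using assms(2) by (intro AE_I2) (simp add: randomized_alg_def)
  ultimately show ?thesis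
    by eventually_elim (simp add: correct_alg_def)
qed

text \<open>The true values \<open>l\<close> and at most 4 are more than \<open>2 * e\<close> apart,
  so a correct algorithm occupies a cell on at least one of the two inputs.\<close>

lemma worst_case_space_ge_half:
  assumes "finite S" "randomized_alg S l P" "approximates_longest_palindrome S l e P"
    and ab: "a \<in> S" "b \<in> S" "a \<noteq> b" and l: "2 * e + 5 \<le> l"
  shows "ennreal (1 / 2) \<le> worst_case_space S l P"
proof -
  define x where "x = replicate l a"
  define y where "y = short_palindromes_word a b l"
  have xy: "x \<in> streams_of_length S l" "y \<in> streams_of_length S l"
    using ab by (auto simp: x_def y_def streams_of_length_def short_palindromes_word_def)
  have lx: "longest_palindrome_length x = l"
    by (subst longest_palindrome_length_palindrome) (auto simp: palindrome_def x_def)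
  have ly: "longest_palindrome_length y \<le> 4"
    unfolding y_def by (rule longest_palindrome_length_short_palindromes_word[OF ab(3)])
  have "x \<noteq> y"
    using lx ly l by auto
  have "AE A in P. 1 / 2 * real (card {x, y}) \<le> real (\<Sum>w\<in>{x, y}. space_used A w)"
    using AE_correct_alg[OF assms(1-3)]
  proof eventually_elim
    case (elim A)
    have "\<not> (space_used A x = 0 \<and> space_used A y = 0)"
    proof
      assume "space_used A x = 0 \<and> space_used A y = 0"
      then have "result A x = result A y"
        by (simp add: result_no_space)
      moreover have "\<bar>result A x - real l\<bar> \<le> real e"
        "\<bar>result A y - real (longest_palindrome_length y)\<bar> \<le> real e"
        using elim xy lx by (auto simp: correct_alg_def)
      ultimately show False
        using ly l by linarith
    qed
    then have "1 \<le> space_used A x + space_used A y" by linarith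
    then have "1 \<le> real (space_used A x + space_used A y)" by linarith
    then show ?case
      using \<open>x \<noteq> y\<close> by simp
  qed
  then show ?thesis
    using xy by (intro worst_case_space_ge_average[OF assms(2), of "{x, y}" "\<lambda>w. w"]) auto
qed

lemma memory_after_padded_inj:
  assumes A: "correct_alg S l e A" and ab: "a \<in> S" "b \<in> S" "a \<noteq> b"
    and c: "c \<in> lists S" "palindrome c"
    and l: "l = 2 * (2 * e + 1 + m) + length c"
  shows "inj_on (\<lambda>u. memory_after A (padded a b e u) (2 * e + 1 + m)) {u \<in> lists S. length u = m}"
proof (rule inj_onI, rule ccontr)
  fix u v
  assume u: "u \<in> {u \<in> lists S. length u = m}" and v: "v \<in> {u \<in> lists S. length u = m}"
    and eq: "memory_after A (padded a b e u) (2 * e + 1 + m) =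
      memory_after A (padded a b e v) (2 * e + 1 + m)"
    and "u \<noteq> v"
  \<comment> \<open>This continuation turns the prefix for \<open>v\<close> into a palindrome of
    length \<open>l\<close>, but not the one for \<open>u\<close>.\<close>
  define z where "z = c @ rev (padded a b e v)"
  have mem: "padded a b e x \<in> lists S" if "x \<in> lists S" for x
    using that ab by (auto simp: padded_def)
  have streams: "padded a b e x @ z \<in> streams_of_length S l"
    if "x \<in> {u \<in> lists S. length u = m}" for x
    using that mem[of x] mem[of v] v c(1) l by (auto simp: streams_of_length_def z_def)
  have "result A (padded a b e u @ z) = result A (padded a b e v @ z)"
    using eq u v by (intro result_append_eq) auto
  moreover have "longest_palindrome_length (padded a b e v @ z) = l"
    using c(2) v l
    by (subst longest_palindrome_length_palindrome) (auto simp: palindrome_def z_def)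
  moreover have "longest_palindrome_length (padded a b e u @ z) + 2 * e < l"
    using longest_palindrome_length_padded[of a b u v "padded a b e u @ z" e c] ab(3) u v
      \<open>u \<noteq> v\<close> l by (simp add: z_def)
  moreover have "\<bar>result A (padded a b e x @ z) -
      real (longest_palindrome_length (padded a b e x @ z))\<bar> \<le> real e"
    if "x \<in> {u \<in> lists S. length u = m}" for x
    using A streams[OF that] by (simp add: correct_alg_def)
  note this[OF u] this[OF v]
  ultimately show False by linarith
qed

lemma worst_case_space_ge_linear:
  assumes S: "finite S" "card S \<ge> 2"
    and P: "randomized_alg S l P" "approximates_longest_palindrome S l e P"
    and ab: "a \<in> S" "b \<in> S" "a \<noteq> b"
    and l: "l div 2 = 2 * e + 1 + m"
  shows "ennreal (real (m - 1) / 2) \<le> worst_case_space S l P"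
proof -
  \<comment> \<open>A single middle letter for odd \<open>l\<close>, nothing for even
    \<open>l\<close>.\<close>
  define c where "c = replicate (l mod 2) a"
  have c: "c \<in> lists S" "palindrome c"
    using ab by (auto simp: c_def palindrome_def)
  have lc: "l = 2 * (2 * e + 1 + m) + length c"
    unfolding l[symmetric] by (simp add: c_def)
  define F where "F = {u \<in> lists S. length u = m}"
  \<comment> \<open>Only the memory after the prefix is counted, so any completion over
    \<open>S\<close> to length \<open>l\<close> would serve.\<close>
  define g where "g u = padded a b e u @ c @ rev (padded a b e u)" for u
  have F_eq: "F = {u. set u \<subseteq> S \<and> length u = m}"
    by (auto simp: F_def)
  have finF: "finite F" and cardF: "card F = card S ^ m"
    unfolding F_eq using S(1) finite_lists_length_eq card_lists_length_eq by auto
  have "F \<noteq> {}"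
    using cardF S(2) by auto
  have g: "g ` F \<subseteq> streams_of_length S l"
    using ab c(1) lc by (auto simp: F_def g_def streams_of_length_def padded_def)
  have "AE A in P. real (m - 1) / 2 * real (card F) \<le> real (\<Sum>u\<in>F. space_used A (g u))"
    using AE_correct_alg[OF S(1) P]
  proof eventually_elim
    case (elim A)
    define f where "f u = memory_after A (padded a b e u) (2 * e + 1 + m)" for u
    have "inj_on f F"
      unfolding f_def F_def by (rule memory_after_padded_inj[OF elim ab c lc])
    moreover have "f ` F \<subseteq> lists S"
    proof (rule image_subsetI)
      fix u assume "u \<in> F"
      then show "f u \<in> lists S"
        unfolding f_def using elim ab
        by (intro memory_after_in_lists) (auto simp: correct_alg_def F_def padded_def)
    qed
    ultimately have "(m - 1) * card F \<le> 2 * (\<Sum>u\<in>F. length (f u))"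
      by (rule sum_length_ge[OF S finF cardF])
    also have "\<dots> \<le> 2 * (\<Sum>u\<in>F. space_used A (g u))"
    proof (intro mult_le_mono order_refl sum_mono)
      fix u assume "u \<in> F"
      then have "f u = memory_after A (g u) (2 * e + 1 + m)"
        unfolding f_def g_def by (subst memory_after_append) (auto simp: F_def)
      then show "length (f u) \<le> space_used A (g u)"
        using \<open>u \<in> F\<close> length_memory_after_le_space_used[of "2 * e + 1 + m" "g u" A]
        by (simp add: g_def F_def)
    qed
    finally have "real ((m - 1) * card F) \<le> real (2 * (\<Sum>u\<in>F. space_used A (g u)))"
      by (rule of_nat_mono)
    then show ?case by simp
  qed
  then show ?thesis
    by (rule worst_case_space_ge_average[OF P(1) finF \<open>F \<noteq> {}\<close> g])
qed

theorem theorem5: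
  "\<exists>c::real. c > 0 \<and>
     (\<forall>(S::nat set) (l::nat) (e::nat) (P::stream_alg measure).
        finite S \<longrightarrow> card S \<ge> 2 \<longrightarrow> e \<ge> 1 \<longrightarrow> 2 * e + 5 \<le> l \<longrightarrow>
        randomized_alg S l P \<longrightarrow> approximates_longest_palindrome S l e P \<longrightarrow>
        worst_case_space S l P \<ge> ennreal (c * (real l / real e)))"
\<comment> \<open>The constant fits both ranges: \<open>l \<le> 16 * e\<close> gives
  \<open>l / (32 * e) \<le> 1 / 2\<close>, and otherwise \<open>l \<le> 16 * (m - 1)\<close> gives
  \<open>l / 32 \<le> (m - 1) / 2\<close>.\<close>
proof (intro exI[of _ "1 / 32 :: real"] conjI allI impI)
  fix S :: "nat set" and l e :: nat and P :: "stream_alg measure"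
  assume S: "finite S" "card S \<ge> 2" and e: "e \<ge> 1" and l: "2 * e + 5 \<le> l"
    and P: "randomized_alg S l P" "approximates_longest_palindrome S l e P"
  obtain a b where ab: "a \<in> S" "b \<in> S" "a \<noteq> b"
    using S(2) by (meson card_2_iff' obtain_subset_with_card_n subsetD)
  show "ennreal (1 / 32 * (real l / real e)) \<le> worst_case_space S l P"
  proof (cases "l \<le> 16 * e")
    case True
    then have "1 / 32 * (real l / real e) \<le> 1 / 2"
      using e by (simp add: field_simps)
    then have "ennreal (1 / 32 * (real l / real e)) \<le> ennreal (1 / 2)"
      by (rule ennreal_leI)
    also have "\<dots> \<le> worst_case_space S l P"
      by (rule worst_case_space_ge_half[OF S(1) P ab l])
    finally show ?thesis .
  next
    case False
    define m where "m = l div 2 - (2 * e + 1)"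
    have m: "l div 2 = 2 * e + 1 + m"
      unfolding m_def using False e by linarith
    have "l \<le> 16 * (m - 1)"
      using False e m by linarith
    then have "real l / 16 \<le> real (m - 1)" by linarith
    \<comment> \<open>For long streams the bound obtained is linear in \<open>l\<close> itself;
      dividing by \<open>e \<ge> 1\<close> only weakens it.\<close>
    moreover have "real l / real e \<le> real l"
      using divide_left_mono[of 1 "real e" "real l"] e by simp
    ultimately have "1 / 32 * (real l / real e) \<le> real (m - 1) / 2" by linarith
    then have "ennreal (1 / 32 * (real l / real e)) \<le> ennreal (real (m - 1) / 2)"
      by (rule ennreal_leI)
    also have "\<dots> \<le> worst_case_space S l P"
      by (rule worst_case_space_ge_linear[OF S P ab m])
    finally show ?thesis .
  qed
qed simp

end
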